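(* Let $N\ge 2$, let $\mathcal{U}$ be a Hilbert space and let $f\in\mathcal{P}_N(\mathcal{U})$. Then the function $$g(z_1,\ldots,z_{N-1}):=f(z_1,\ldots,z_{N-1},1)$$ is holomorphic in the domain $\Omega_{N-1}^+:=\bigcup_{\lambda\in\mathbb{T}\cap\Pi}(\lambda\Pi)^{N-1}\subset\mathbb{C}^{N-1}$ and has the properties: (i) $g(\overline{z'})=g(z')^*$ for all $z'\in\Omega_{N-1}^+$; (ii) $\mathrm{Re}\left[z_Ng\left(\frac{z_1}{z_N},\ldots,\frac{z_{N-1}}{z_N}\right)\right]\ge 0$ for all $z=(z_1,\ldots,z_{N-1},z_N)\in\Pi^N$. Conversely, let an $L(\mathcal{U})$-valued function $g(z')=g(z_1,\ldots,z_{N-1})$ be holomorphic in the domain $\Omega_{N-1}^+$ and satisfy conditions (i) and (ii). Then the function $$f(z_1,\ldots,z_{N-1},z_N):=z_Ng\left(\frac{z_1}{z_N},\ldots,\frac{z_{N-1}}{z_N}\right)$$ is correctly defined on $\Omega_N$ and belongs to the class $\mathcal{P}_N(\mathcal{U})$.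
   Context: All Hilbert spaces are complex; $L(\mathcal{U})$ denotes the bounded linear operators on $\mathcal{U}$; $\mathrm{Re}\,X=\frac{1}{2}(X+X^* )$ for an operator $X$, and $\ge0$ means positive semidefinite. $\Pi=\{z\in\mathbb{C}:\mathrm{Re}\,z>0\}$, $\mathbb{T}$ is the unit circle, $\Omega_N=\bigcup_{\lambda\in\mathbb{T}}(\lambda\Pi)^N\subset\mathbb{C}^N$; the bar denotes coordinatewise complex conjugation. The class $\mathcal{P}_N(\mathcal{U})$ consists of all $L(\mathcal{U})$-valued functions $f$ holomorphic in $\Omega_N$ such that: $f(\lambda z_1,\ldots,\lambda z_N)=\lambda f(z_1,\ldots,z_N)$ for $\lambda\in\mathbb{C}\setminus\{0\}$, $z\in\Omega_N$; $f(z)+f(z)^*\ge 0$ for $z\in\Pi^N$; $f(\bar z)=f(z)^*$ for $z\in\Omega_N$. *)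

theory Defs
  imports "HOL-Analysis.Analysis" "HOL-Library.Nonpos_Ints"
begin

section \<open>Complex Hilbert spaces\<close>

class complex_vector = real_vector +
  fixes scaleC :: "complex \<Rightarrow> 'a \<Rightarrow> 'a"  (infixr \<open>*\<^sub>C\<close> 75)
  assumes scaleC_add_right: "c *\<^sub>C (x + y) = c *\<^sub>C x + c *\<^sub>C y"
    and scaleC_add_left: "(c + d) *\<^sub>C x = c *\<^sub>C x + d *\<^sub>C x"
    and scaleC_scaleC: "c *\<^sub>C d *\<^sub>C x = (c * d) *\<^sub>C x"
    and scaleC_of_real: "complex_of_real r *\<^sub>C x = r *\<^sub>R x"

class complex_normed_vector = complex_vector + real_normed_vector +
  assumes norm_scaleC: "norm (c *\<^sub>C x) = cmod c * norm x"

text \<open>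
  The complex inner product is linear in its first argument.  Its real part is the
  inner product of the underlying real space, so that the norm is the usual one,
  \<open>norm x = sqrt (cinner x x)\<close>, and the library for \<open>real_inner\<close> applies.
\<close>

class complex_inner = complex_vector + real_inner +
  fixes cinner :: "'a \<Rightarrow> 'a \<Rightarrow> complex"
  assumes cinner_commute: "cinner x y = cnj (cinner y x)"
    and cinner_add_left: "cinner (x + y) z = cinner x z + cinner y z"
    and cinner_scaleC_left: "cinner (c *\<^sub>C x) y = c * cinner x y"
    and Re_cinner: "Re (cinner x y) = inner x y"

class chilbert_space = complex_inner + complete_space

context complex_inner
begin

lemma cinner_add_right: "cinner x (y + z) = cinner x y + cinner x z"
  by (metis cinner_add_left cinner_commute complex_cnj_add)

lemma cinner_scaleC_right: "cinner x (c *\<^sub>C y) = cnj c * cinner x y"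
  by (metis cinner_scaleC_left cinner_commute complex_cnj_mult)

lemma cinner_self: "cinner x x = complex_of_real (inner x x)"
proof -
  have "Im (cinner x x) = 0"
    using arg_cong[OF cinner_commute[of x x], of Im] by simp
  then show ?thesis by (simp add: complex_eq_iff Re_cinner)
qed

lemma Im_cinner: "Im (cinner x y) = inner x (\<i> *\<^sub>C y)"
  by (simp flip: Re_cinner add: cinner_scaleC_right)

end

instance complex_inner \<subseteq> complex_normed_vector
proof
  fix c :: complex and x :: 'a
  have "complex_of_real (inner (c *\<^sub>C x) (c *\<^sub>C x)) = c * cnj c * complex_of_real (inner x x)"
    by (simp flip: cinner_self add: cinner_scaleC_left cinner_scaleC_right mult.assoc)
  also have "\<dots> = complex_of_real ((cmod c)\<^sup>2 * inner x x)"
    by (simp add: complex_norm_square del: of_real_power)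
  finally have "inner (c *\<^sub>C x) (c *\<^sub>C x) = (cmod c)\<^sup>2 * inner x x"
    using of_real_eq_iff by blast
  then show "norm (c *\<^sub>C x) = cmod c * norm x"
    by (simp add: norm_eq_sqrt_inner real_sqrt_mult)
qed

instantiation complex :: chilbert_space
begin

definition scaleC_complex :: "complex \<Rightarrow> complex \<Rightarrow> complex"
  where "scaleC_complex c x = c * x"

definition cinner_complex :: "complex \<Rightarrow> complex \<Rightarrow> complex"
  where "cinner_complex x y = x * cnj y"

instance
  by standard
    (auto simp: scaleC_complex_def cinner_complex_def algebra_simps scaleR_conv_of_real
      inner_complex_def)

end

section \<open>Bounded linear operators\<close>

instantiation blinfun :: (real_normed_vector, complex_normed_vector) complex_normed_vector
begin

lift_definition scaleC_blinfun :: "complex \<Rightarrow> ('a \<Rightarrow>\<^sub>L 'b) \<Rightarrow> ('a \<Rightarrow>\<^sub>L 'b)"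
  is "\<lambda>c f x. c *\<^sub>C f x"
proof -
  fix c :: complex and f :: "'a \<Rightarrow> 'b"
  assume "bounded_linear f"
  then interpret f: bounded_linear f .
  show "bounded_linear (\<lambda>x. c *\<^sub>C f x)"
  proof (rule bounded_linear_intro[where K = "cmod c * onorm f"])
    fix x y :: 'a and r :: real
    show "c *\<^sub>C f (x + y) = c *\<^sub>C f x + c *\<^sub>C f y"
      by (simp add: f.add scaleC_add_right)
    show "c *\<^sub>C f (r *\<^sub>R x) = r *\<^sub>R (c *\<^sub>C f x)"
      by (simp add: f.scaleR scaleC_scaleC mult.commute flip: scaleC_of_real)
    show "norm (c *\<^sub>C f x) \<le> norm x * (cmod c * onorm f)"
      using mult_left_mono[OF onorm[OF \<open>bounded_linear f\<close>, of x], of "cmod c"]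
      by (simp add: norm_scaleC algebra_simps)
  qed
qed

instance
proof
  fix c d :: complex and r :: real and x y :: "'a \<Rightarrow>\<^sub>L 'b"
  show "c *\<^sub>C (x + y) = c *\<^sub>C x + c *\<^sub>C y"
    by transfer (simp add: scaleC_add_right)
  show "(c + d) *\<^sub>C x = c *\<^sub>C x + d *\<^sub>C x"
    by transfer (simp add: scaleC_add_left)
  show "c *\<^sub>C d *\<^sub>C x = (c * d) *\<^sub>C x"
    by transfer (simp add: scaleC_scaleC)
  show "complex_of_real r *\<^sub>C x = r *\<^sub>R x"
    by transfer (simp add: scaleC_of_real)
  show "norm (c *\<^sub>C x) = cmod c * norm x"
  proof (cases "c = 0")
    case True
    then have "c *\<^sub>C x = 0"
      using scaleC_of_real[of 0] by (intro blinfun_eqI) (simp add: scaleC_blinfun.rep_eq)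
    with True show ?thesis by simp
  next
    case False
    have le: "norm (a *\<^sub>C z) \<le> cmod a * norm z" for a and z :: "'a \<Rightarrow>\<^sub>L 'b"
    proof (rule norm_blinfun_bound)
      fix v
      have "norm (blinfun_apply (a *\<^sub>C z) v) = cmod a * norm (blinfun_apply z v)"
        by transfer (simp add: norm_scaleC)
      also have "\<dots> \<le> cmod a * (norm z * norm v)"
        by (intro mult_left_mono norm_blinfun) simp
      finally show "norm (blinfun_apply (a *\<^sub>C z) v) \<le> cmod a * norm z * norm v"
        by (simp add: mult.assoc)
    qed simp
    have "inverse c *\<^sub>C c *\<^sub>C x = x"
      using False scaleC_of_real[of 1]
      by (intro blinfun_eqI) (simp add: scaleC_blinfun.rep_eq scaleC_scaleC)
    with le[of "inverse c" "c *\<^sub>C x"] have "norm x \<le> inverse (cmod c) * norm (c *\<^sub>C x)"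
      by (simp add: norm_inverse)
    with False have "cmod c * norm x \<le> norm (c *\<^sub>C x)"
      by (simp add: field_simps)
    with le[of c x] show ?thesis by simp
  qed
qed

end

text \<open>
  Elements of \<open>'u \<Rightarrow>\<^sub>L 'u\<close> are only real linear; \<open>L(\<U>)\<close> is the subspace of the complex linear ones.
\<close>

definition clinear_ops :: "('u::complex_normed_vector \<Rightarrow>\<^sub>L 'u) set"
  where "clinear_ops = {A :: 'u \<Rightarrow>\<^sub>L 'u. \<forall>c x. A (c *\<^sub>C x) = c *\<^sub>C A x}"

definition adj :: "('u::chilbert_space \<Rightarrow>\<^sub>L 'u) \<Rightarrow> ('u \<Rightarrow>\<^sub>L 'u)"
  where "adj A = (THE B :: 'u \<Rightarrow>\<^sub>L 'u. \<forall>x y. cinner (A x) y = cinner x (B y))"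

definition Re_op :: "('u::chilbert_space \<Rightarrow>\<^sub>L 'u) \<Rightarrow> ('u \<Rightarrow>\<^sub>L 'u)"
  where "Re_op A = (1/2) *\<^sub>R (A + adj A)"

definition psd :: "('u::chilbert_space \<Rightarrow>\<^sub>L 'u) \<Rightarrow> bool"
  where "psd A \<longleftrightarrow> (\<forall>x. cinner (A x) x \<in> \<real>\<^sub>\<ge>\<^sub>0)"

lemma riesz_real:
  fixes \<phi> :: "'a::{real_inner,complete_space} \<Rightarrow> real"
  assumes "bounded_linear \<phi>"
  shows "\<exists>y. \<forall>x. \<phi> x = inner x y"
proof -
  interpret \<phi>: bounded_linear \<phi> by fact
  define J where "J x = inner x x - 2 * \<phi> x" for x
  obtain K where K: "\<And>x. norm (\<phi> x) \<le> norm x * K"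
    using \<phi>.bounded by blast
  have bdd: "- (K\<^sup>2) \<le> J x" for x
  proof -
    have "0 \<le> (norm x - K)\<^sup>2" by simp
    moreover have "\<phi> x \<le> norm x * K" using K[of x] by (simp add: abs_le_iff)
    ultimately show ?thesis
      by (simp add: J_def power2_diff flip: power2_norm_eq_inner)
  qed
  define m where "m = Inf (range J)"
  have bb: "bdd_below (range J)" using bdd by (auto intro!: bdd_belowI)
  have m_le: "m \<le> J x" for x unfolding m_def by (rule cInf_lower[OF _ bb]) simp
  have "\<exists>x. J x < m + inverse (real (Suc n))" for n
    using cInf_lessD[of "range J" "m + inverse (real (Suc n))"] by (auto simp: m_def)
  then obtain X where X: "\<And>n. J (X n) < m + inverse (real (Suc n))" by metis
  have par: "inner (x - y) (x - y) = 2 * J x + 2 * J y - 4 * J ((1/2) *\<^sub>R (x + y))" for x y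
    by (simp add: J_def \<phi>.add \<phi>.scaleR inner_diff_left inner_diff_right inner_add_left
        inner_add_right inner_commute algebra_simps)
  have close: "inner (X i - X j) (X i - X j) \<le> 2 * inverse (real (Suc i)) + 2 * inverse (real (Suc j))"
    for i j
    using par[of "X i" "X j"] X[of i] X[of j] m_le[of "(1/2) *\<^sub>R (X i + X j)"] by linarith
  have "Cauchy X"
  proof (rule metric_CauchyI)
    fix e :: real
    assume e: "0 < e"
    then obtain M where M: "inverse (real (Suc M)) < e\<^sup>2 / 4"
      using reals_Archimedean[of "e\<^sup>2 / 4"] by auto
    have "dist (X i) (X j) < e" if "i \<ge> M" "j \<ge> M" for i j
    proof -
      have "inverse (real (Suc i)) \<le> inverse (real (Suc M))" "inverse (real (Suc j)) \<le> inverse (real (Suc M))"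
        using that by (auto intro!: le_imp_inverse_le)
      with close[of i j] M have "inner (X i - X j) (X i - X j) < e\<^sup>2" by linarith
      then have "(dist (X i) (X j))\<^sup>2 < e\<^sup>2"
        by (simp add: dist_norm power2_norm_eq_inner)
      then show ?thesis using e by (simp add: power2_less_imp_less)
    qed
    then show "\<exists>M. \<forall>i\<ge>M. \<forall>j\<ge>M. dist (X i) (X j) < e" by blast
  qed
  then obtain y where y: "X \<longlonglongrightarrow> y"
    using Cauchy_convergent convergent_def by blast
  have "(\<lambda>n. J (X n)) \<longlonglongrightarrow> J y"
    unfolding J_def by (intro tendsto_intros \<phi>.tendsto y)
  moreover have "(\<lambda>n. m + inverse (real (Suc n))) \<longlonglongrightarrow> m + 0"
    by (intro tendsto_intros LIMSEQ_inverse_real_of_nat)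
  ultimately have "J y \<le> m + 0"
    by (rule LIMSEQ_le) (use X less_imp_le in blast)
  then have min: "J y \<le> J v" for v using m_le[of v] by linarith
  have "\<phi> v = inner v y" for v
  proof (rule ccontr)
    assume ne: "\<phi> v \<noteq> inner v y"
    define b where "b = inner v y - \<phi> v"
    have pos: "0 \<le> t * (t * inner v v + 2 * b)" for t
    proof -
      have "J (y + t *\<^sub>R v) - J y = t * (t * inner v v + 2 * b)"
        by (simp add: J_def b_def \<phi>.add \<phi>.scaleR inner_add_left inner_add_right
            inner_commute algebra_simps)
      with min[of "y + t *\<^sub>R v"] show ?thesis by linarith
    qed
    define q where "q = inner v v + 1"
    have q: "q > 0" "inner v v = q - 1" by (auto simp: q_def add_nonneg_pos)
    have "(- b / q) * ((- b / q) * inner v v + 2 * b) = - (b\<^sup>2 * (q + 1) / q\<^sup>2)"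
      using q(1) unfolding q(2) by (simp add: field_simps power2_eq_square)
    with pos[of "- b / q"] have "b\<^sup>2 * (q + 1) / q\<^sup>2 \<le> 0" by linarith
    moreover have "b\<^sup>2 * (q + 1) / q\<^sup>2 > 0"
      using q(1) ne by (intro divide_pos_pos mult_pos_pos) (auto simp: b_def)
    ultimately show False by linarith
  qed
  then show ?thesis by blast
qed

lemma adj_exists:
  fixes A :: "'u::chilbert_space \<Rightarrow>\<^sub>L 'u"
  assumes A: "A \<in> clinear_ops"
  shows "\<exists>B. \<forall>x y. cinner (A x) y = cinner x (blinfun_apply B y)"
proof -
  have "\<exists>w. \<forall>x. inner (A x) y = inner x w" for y
    by (rule riesz_real) (intro bounded_linear_intros)
  then obtain B where B: "\<And>x y. inner (A x) y = inner x (B y)" by metis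
  have ext: "u = v" if "\<And>x. inner x u = inner x v" for u v :: 'u
    using that[of "u - v"] by (metis inner_diff_right inner_eq_zero_iff right_minus_eq)
  have "bounded_linear B"
  proof (rule bounded_linear_intro[where K = "norm A"])
    fix x y and r :: real
    show "B (x + y) = B x + B y"
      by (rule ext) (simp add: inner_add_right flip: B)
    show "B (r *\<^sub>R x) = r *\<^sub>R B x"
      by (rule ext) (simp flip: B)
    have "(norm (B x))\<^sup>2 = inner (A (B x)) x"
      by (simp add: B power2_norm_eq_inner)
    also have "\<dots> \<le> norm (A (B x)) * norm x" by (rule norm_cauchy_schwarz)
    also have "\<dots> \<le> norm A * norm (B x) * norm x"
      by (intro mult_right_mono norm_blinfun) simp
    finally have "norm (B x) * norm (B x) \<le> norm (B x) * (norm x * norm A)"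
      by (simp add: power2_eq_square algebra_simps)
    then show "norm (B x) \<le> norm x * norm A"
      by (cases "norm (B x) = 0") (auto simp: mult_le_cancel_left)
  qed
  then have app: "blinfun_apply (Blinfun B) = B" by (rule bounded_linear_Blinfun_apply)
  have "cinner (A x) y = cinner x (B y)" for x y
  proof (rule complex_eqI)
    show "Re (cinner (A x) y) = Re (cinner x (B y))" by (simp add: Re_cinner B)
    have "cinner (A (\<i> *\<^sub>C x)) y = \<i> * cinner (A x) y"
      using A by (simp add: clinear_ops_def cinner_scaleC_left)
    moreover have "cinner (\<i> *\<^sub>C x) (B y) = \<i> * cinner x (B y)"
      by (simp add: cinner_scaleC_left)
    ultimately show "Im (cinner (A x) y) = Im (cinner x (B y))"
      using B[of "\<i> *\<^sub>C x" y] by (simp flip: Re_cinner)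
  qed
  with app show ?thesis by metis
qed

lemma adj_unique:
  fixes A B :: "'u::chilbert_space \<Rightarrow>\<^sub>L 'u"
  assumes "\<And>x y. cinner (A x) y = cinner x (B y)"
  shows "adj A = B"
  unfolding adj_def
proof (rule the_equality)
  show "\<forall>x y. cinner (A x) y = cinner x (B y)" using assms by blast
next
  fix C :: "'u \<Rightarrow>\<^sub>L 'u"
  assume C: "\<forall>x y. cinner (A x) y = cinner x (C y)"
  have "inner (C y - B y) (C y) = inner (C y - B y) (B y)" for y
    using C assms by (metis Re_cinner)
  then have "inner (C y - B y) (C y - B y) = 0" for y
    by (simp add: inner_diff_right)
  then show "C = B" by (intro blinfun_eqI) simp
qed

lemma adj_works:
  fixes A :: "'u::chilbert_space \<Rightarrow>\<^sub>L 'u"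
  assumes "A \<in> clinear_ops"
  shows "cinner (A x) y = cinner x (adj A y)"
  using adj_exists[OF assms] adj_unique by metis

section \<open>Holomorphic operator functions and the class P\<close>

text \<open>
  Holomorphy on an open set: complex Frechet differentiability at every point, with respect
  to the operator norm when the values are operators.  Functions are total, but only their
  values on \<open>S\<close> matter for open \<open>S\<close>.
\<close>

definition holomorphic_map_on ::
    "(complex ^ 'n \<Rightarrow> 'b::complex_normed_vector) \<Rightarrow> (complex ^ 'n) set \<Rightarrow> bool"
  where "holomorphic_map_on f S \<longleftrightarrow>
    (\<forall>z\<in>S. \<exists>D. (f has_derivative D) (at z) \<and> (\<forall>c v. D (c *s v) = c *\<^sub>C D v))"

definition rhp :: "complex set"
  where "rhp = {z. Re z > 0}"

definition cpower :: "complex set \<Rightarrow> (complex ^ 'n) set"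
  where "cpower S = {z. \<forall>j. z $ j \<in> S}"

definition Omega :: "(complex ^ 'n) set"
  where "Omega = (\<Union>\<mu>\<in>sphere 0 1. cpower ((\<lambda>w. \<mu> * w) ` rhp))"

definition Omega_plus :: "(complex ^ 'n) set"
  where "Omega_plus = (\<Union>\<mu>\<in>sphere 0 1 \<inter> rhp. cpower ((\<lambda>w. \<mu> * w) ` rhp))"

definition cnj_vec :: "complex ^ 'n \<Rightarrow> complex ^ 'n"
  where "cnj_vec z = (\<chi> j. cnj (z $ j))"

text \<open>
  Membership in \<open>class_P\<close> constrains the total function \<open>f\<close> only on \<open>Omega\<close>
  (which is stable under conjugation and nonzero scalars).
\<close>

definition class_P :: "(complex ^ 'n \<Rightarrow> ('u::chilbert_space \<Rightarrow>\<^sub>L 'u)) set"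
  where "class_P = {f.
    f ` Omega \<subseteq> clinear_ops \<and>
    holomorphic_map_on f Omega \<and>
    (\<forall>\<mu> z. \<mu> \<noteq> 0 \<longrightarrow> z \<in> Omega \<longrightarrow> f (\<mu> *s z) = \<mu> *\<^sub>C f z) \<and>
    (\<forall>z\<in>cpower rhp. psd (f z + adj (f z))) \<and>
    (\<forall>z\<in>Omega. f (cnj_vec z) = adj (f z))}"

text \<open>
  If \<open>'n\<close> has \<open>N - 1 \<ge> 1\<close> elements then \<open>'n option\<close> has \<open>N \<ge> 2\<close>.  The coordinates
  \<open>z\<^sub>1, \<dots>, z\<^sub>N\<^sub>-\<^sub>1\<close> are indexed by \<open>Some j\<close>, and \<open>z\<^sub>N\<close> is \<open>z $ None\<close>.
\<close>

definition append_coord :: "complex ^ 'n \<Rightarrow> complex \<Rightarrow> complex ^ 'n option"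
  where "append_coord z' w = (\<chi> i. case i of None \<Rightarrow> w | Some j \<Rightarrow> z' $ j)"

definition dehomogenize :: "complex ^ 'n option \<Rightarrow> complex ^ 'n"
  where "dehomogenize z = (\<chi> j. z $ Some j / z $ None)"

end

theory Submission
  imports Defs
begin

text \<open>
  The theorem is the usual dictionary between homogeneous functions of degree one and their
  restrictions to the affine chart \<open>z\<^sub>N = 1\<close>.  Both directions rest on one geometric observation:
  rotating by a unimodular factor and taking right half-planes amounts to the existence of a
  nonzero \<open>\<nu>\<close> with \<open>Re (\<nu> z\<^sub>j) > 0\<close> for all \<open>j\<close> (take \<open>\<nu>\<close> conjugate to the rotation).
  In this form \<open>Omega\<close> is visibly a cone over the nonzero complex numbers, its points have no
  vanishing coordinate, and the extra condition \<open>Re \<mu> > 0\<close> in \<open>Omega_plus\<close> says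
  precisely that an additional coordinate equal to \<open>1\<close> is admissible
  (\<open>Omega_plus_iff_append_coord\<close>).  So \<open>Omega_plus\<close> is the slice \<open>z\<^sub>N = 1\<close> of \<open>Omega\<close>, and
  \<open>Omega\<close> is the cone over that slice.

  Given this, \<open>f z = z\<^sub>N f (z / z\<^sub>N)\<close> by homogeneity, which identifies condition (ii) on \<open>g\<close>
  with positivity of \<open>f\<close>, up to the factor \<open>1/2\<close> in the real part.  Complex conjugation
  commutes with forming ratios and with inserting the coordinate \<open>1\<close>, which matches the two
  symmetry conditions, and holomorphy passes both ways because \<open>z' \<mapsto> (z', 1)\<close> and
  \<open>z \<mapsto> (z\<^sub>1 / z\<^sub>N, \<dots>, z\<^sub>N\<^sub>-\<^sub>1 / z\<^sub>N)\<close> have holomorphic coordinates.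
\<close>

section \<open>The cone \<open>Omega\<close> and its affine slice\<close>

text \<open>
  On the unit circle \<open>cnj \<mu>\<close> inverts \<open>\<mu>\<close>, so multiplying by it undoes the rotation.
\<close>

lemma mem_rotated_rhp_iff:
  assumes "cmod \<mu> = 1"
  shows "w \<in> (\<lambda>w. \<mu> * w) ` rhp \<longleftrightarrow> Re (cnj \<mu> * w) > 0"
proof -
  have unit: "\<mu> * cnj \<mu> = 1"
    using assms by (simp flip: complex_norm_square)
  show ?thesis
  proof
    assume "w \<in> (\<lambda>w. \<mu> * w) ` rhp"
    then obtain v where v: "Re v > 0" "w = \<mu> * v" by (auto simp: rhp_def)
    then have "cnj \<mu> * w = v"
      using unit by (metis mult.assoc mult.commute mult_1)
    with v(1) show "Re (cnj \<mu> * w) > 0" by (simp only:)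
  next
    assume "Re (cnj \<mu> * w) > 0"
    moreover have "w = \<mu> * (cnj \<mu> * w)"
      using unit by (metis mult.assoc mult_1)
    ultimately show "w \<in> (\<lambda>w. \<mu> * w) ` rhp" unfolding rhp_def by blast
  qed
qed

lemma Re_sgn_mult: "Re (sgn \<nu> * w) = Re (\<nu> * w) / cmod \<nu>"
  by (simp add: sgn_div_norm divide_inverse algebra_simps)

text \<open>
  Positivity of a real part depends only on the argument of the multiplier, so its modulus need
  not be normalised.  Without the normalisation, multiplying \<open>z\<close> by a nonzero scalar is absorbed
  by dividing \<open>\<nu>\<close> by it, and a coordinate equal to \<open>1\<close> turns into a condition on \<open>\<nu>\<close> alone.
\<close>

lemma Omega_iff: "z \<in> Omega \<longleftrightarrow> (\<exists>\<nu>. \<nu> \<noteq> 0 \<and> (\<forall>j. Re (\<nu> * z $ j) > 0))"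
proof
  assume "z \<in> Omega"
  then obtain \<mu> where \<mu>: "cmod \<mu> = 1" "\<And>j. z $ j \<in> (\<lambda>w. \<mu> * w) ` rhp"
    by (auto simp: Omega_def cpower_def)
  then show "\<exists>\<nu>. \<nu> \<noteq> 0 \<and> (\<forall>j. Re (\<nu> * z $ j) > 0)"
    by (intro exI[of _ "cnj \<mu>"]) (auto simp: mem_rotated_rhp_iff simp del: times_complex.sel)
next
  assume "\<exists>\<nu>. \<nu> \<noteq> 0 \<and> (\<forall>j. Re (\<nu> * z $ j) > 0)"
  then obtain \<nu> where \<nu>: "\<nu> \<noteq> 0" "\<And>j. Re (\<nu> * z $ j) > 0" by blast
  have unit: "cmod (cnj (sgn \<nu>)) = 1" using \<nu> by (simp add: norm_sgn)
  have "z $ j \<in> (\<lambda>w. cnj (sgn \<nu>) * w) ` rhp" for j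
    unfolding mem_rotated_rhp_iff[OF unit] using \<nu>
    by (simp add: Re_sgn_mult del: times_complex.sel)
  with unit show "z \<in> Omega"
    by (auto simp: Omega_def cpower_def intro!: bexI[of _ "cnj (sgn \<nu>)"])
qed

lemma Omega_plus_iff: "z \<in> Omega_plus \<longleftrightarrow> (\<exists>\<nu>. Re \<nu> > 0 \<and> (\<forall>j. Re (\<nu> * z $ j) > 0))"
proof
  assume "z \<in> Omega_plus"
  then obtain \<mu> where \<mu>: "cmod \<mu> = 1" "Re \<mu> > 0" "\<And>j. z $ j \<in> (\<lambda>w. \<mu> * w) ` rhp"
    by (auto simp: Omega_plus_def cpower_def rhp_def)
  then show "\<exists>\<nu>. Re \<nu> > 0 \<and> (\<forall>j. Re (\<nu> * z $ j) > 0)"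
    by (intro exI[of _ "cnj \<mu>"]) (auto simp: mem_rotated_rhp_iff simp del: times_complex.sel)
next
  assume "\<exists>\<nu>. Re \<nu> > 0 \<and> (\<forall>j. Re (\<nu> * z $ j) > 0)"
  then obtain \<nu> where \<nu>: "Re \<nu> > 0" "\<And>j. Re (\<nu> * z $ j) > 0" by blast
  then have nz: "\<nu> \<noteq> 0" by auto
  have unit: "cmod (cnj (sgn \<nu>)) = 1" using nz by (simp add: norm_sgn)
  have pos: "cnj (sgn \<nu>) \<in> rhp"
    using \<nu>(1) nz Re_sgn_mult[of \<nu> 1] by (simp add: rhp_def)
  have "z $ j \<in> (\<lambda>w. cnj (sgn \<nu>) * w) ` rhp" for j
    unfolding mem_rotated_rhp_iff[OF unit] using \<nu>(2) nz
    by (simp add: Re_sgn_mult del: times_complex.sel)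
  with unit pos show "z \<in> Omega_plus"
    by (auto simp: Omega_plus_def cpower_def intro!: bexI[of _ "cnj (sgn \<nu>)"])
qed

lemma append_coord_nth [simp]:
  "append_coord z' w $ None = w" "append_coord z' w $ Some j = z' $ j"
  by (simp_all add: append_coord_def)

text \<open>
  The coordinate \<open>1\<close> contributes the inequality \<open>Re (\<nu> * 1) > 0\<close>, which is the extra
  condition in \<open>Omega_plus\<close>.
\<close>

lemma Omega_plus_iff_append_coord: "z' \<in> Omega_plus \<longleftrightarrow> append_coord z' 1 \<in> Omega"
proof -
  have "(\<forall>i. Re (\<nu> * append_coord z' 1 $ i) > 0) \<longleftrightarrow>
      Re \<nu> > 0 \<and> (\<forall>j. Re (\<nu> * z' $ j) > 0)" for \<nu>
    by (simp add: split_option_all)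
  moreover have "Re \<nu> > 0 \<Longrightarrow> \<nu> \<noteq> 0" for \<nu> by auto
  ultimately show ?thesis unfolding Omega_plus_iff Omega_iff by blast
qed

lemma cpower_rhp_subset_Omega: "cpower rhp \<subseteq> Omega"
  by (auto simp: Omega_iff cpower_def rhp_def intro!: exI[of _ 1])

lemma Omega_nth_nonzero: "z \<in> Omega \<Longrightarrow> z $ j \<noteq> 0"
  unfolding Omega_iff by (metis less_irrefl mult_zero_right zero_complex.sel(1))

lemma Omega_smult:
  assumes "z \<in> Omega" "c \<noteq> 0"
  shows "c *s z \<in> Omega"
proof -
  obtain \<nu> where \<nu>: "\<nu> \<noteq> 0" "\<And>j. Re (\<nu> * z $ j) > 0" using assms by (auto simp: Omega_iff)
  have "\<nu> / c * (c *s z) $ j = \<nu> * z $ j" for j using assms(2) by simp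
  with \<nu> assms(2) show ?thesis unfolding Omega_iff
    by (intro exI[of _ "\<nu> / c"]) (auto simp del: times_complex.sel)
qed

lemma append_coord_dehomogenize:
  assumes "z $ None \<noteq> 0"
  shows "append_coord (dehomogenize z) 1 = inverse (z $ None) *s z"
  using assms by (simp add: vec_eq_iff split_option_all dehomogenize_def divide_inverse)

lemma dehomogenize_mem_Omega_plus: "z \<in> Omega \<Longrightarrow> dehomogenize z \<in> Omega_plus"
  by (simp add: Omega_plus_iff_append_coord append_coord_dehomogenize Omega_nth_nonzero Omega_smult)

lemma dehomogenize_smult: "c \<noteq> 0 \<Longrightarrow> dehomogenize (c *s z) = dehomogenize z"
  by (simp add: dehomogenize_def vec_eq_iff)

lemma dehomogenize_cnj_vec: "dehomogenize (cnj_vec z) = cnj_vec (dehomogenize z)"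
  by (simp add: dehomogenize_def cnj_vec_def vec_eq_iff)

lemma append_coord_cnj_vec: "append_coord (cnj_vec z') (cnj w) = cnj_vec (append_coord z' w)"
  by (simp add: cnj_vec_def vec_eq_iff split_option_all)

section \<open>Complex scalars and adjoints\<close>

lemma scaleC_one: "1 *\<^sub>C x = (x :: 'a::complex_vector)"
  using scaleC_of_real[of 1 x] by simp

lemma bounded_bilinear_scaleC:
  "bounded_bilinear (scaleC :: complex \<Rightarrow> 'a \<Rightarrow> 'a::complex_normed_vector)"
proof
  fix c :: complex and r :: real and x :: 'a
  show "(r *\<^sub>R c) *\<^sub>C x = r *\<^sub>R (c *\<^sub>C x)"
    by (simp add: scaleR_conv_of_real scaleC_scaleC flip: scaleC_of_real)
  show "c *\<^sub>C (r *\<^sub>R x) = r *\<^sub>R (c *\<^sub>C x)"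
    by (simp add: scaleC_scaleC mult.commute flip: scaleC_of_real)
  show "\<exists>K. \<forall>a (b::'a). norm (a *\<^sub>C b) \<le> norm a * norm b * K"
    by (intro exI[of _ 1]) (simp add: norm_scaleC)
qed (simp_all add: scaleC_add_left scaleC_add_right)

lemma clinear_ops_scaleC: "A \<in> clinear_ops \<Longrightarrow> c *\<^sub>C A \<in> clinear_ops"
  by (simp add: clinear_ops_def scaleC_blinfun.rep_eq scaleC_scaleC mult.commute)

lemma adj_scaleC: "A \<in> clinear_ops \<Longrightarrow> adj (c *\<^sub>C A) = cnj c *\<^sub>C adj A"
  by (rule adj_unique)
    (simp add: scaleC_blinfun.rep_eq cinner_scaleC_left cinner_scaleC_right adj_works)

lemma psd_Re_op_iff: "psd (Re_op A) \<longleftrightarrow> psd (A + adj A)"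
proof -
  have "cinner (r *\<^sub>R x) y = of_real r * cinner x y" for r and x y :: 'a
    by (metis cinner_scaleC_left scaleC_of_real)
  then show ?thesis
    by (simp add: psd_def Re_op_def blinfun.scaleR_left complex_nonneg_Reals_iff)
qed

section \<open>Holomorphic maps\<close>

text \<open>
  A vector is the sum of its coordinates placed on the axes, and placing on an axis is bounded
  linear; this reduces differentiability to the coordinates.
\<close>

lemma has_derivative_vec_componentwise:
  fixes h :: "'a::real_normed_vector \<Rightarrow> 'b::euclidean_space ^ 'm"
  assumes "\<And>i. ((\<lambda>x. h x $ i) has_derivative (\<lambda>v. h' v $ i)) F"
  shows "(h has_derivative h') F"
proof -
  have axis: "bounded_linear (axis i :: 'b \<Rightarrow> 'b ^ 'm)" for i
    by (intro linear_conv_bounded_linear[THEN iffD1] linearI) (auto simp: axis_def vec_eq_iff)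
  have expand: "x = (\<Sum>i\<in>UNIV. axis i (x $ i))" for x :: "'b ^ 'm"
    by (simp add: vec_eq_iff axis_def if_distrib sum.delta cong: if_cong)
  have "((\<lambda>x. \<Sum>i\<in>UNIV. axis i (h x $ i)) has_derivative (\<lambda>v. \<Sum>i\<in>UNIV. axis i (h' v $ i))) F"
    by (intro has_derivative_sum bounded_linear.has_derivative[OF axis] assms)
  then show ?thesis by (simp flip: expand)
qed

text \<open>
  Holomorphy of the inner map is asked of each coordinate because \<open>holomorphic_map_on\<close> takes
  values in a \<open>complex_normed_vector\<close>, a structure that vectors do not carry here.  The
  coordinate derivatives assemble to one that commutes with \<open>*s\<close>, and composing complex linear
  derivatives gives a complex linear one.
\<close>

lemma holomorphic_map_on_compose:
  fixes h :: "complex ^ 'n \<Rightarrow> complex ^ 'm"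
  assumes f: "holomorphic_map_on f T"
    and h: "\<And>i. holomorphic_map_on (\<lambda>z. h z $ i) S"
    and maps: "h ` S \<subseteq> T"
  shows "holomorphic_map_on (\<lambda>z. f (h z)) S"
  unfolding holomorphic_map_on_def
proof
  fix z assume z: "z \<in> S"
  have "\<forall>i. \<exists>D. ((\<lambda>z. h z $ i) has_derivative D) (at z) \<and> (\<forall>c v. D (c *s v) = c *\<^sub>C D v)"
    using h z by (simp add: holomorphic_map_on_def)
  then obtain D where D: "\<And>i. ((\<lambda>z. h z $ i) has_derivative D i) (at z)"
    "\<And>i c v. D i (c *s v) = c * D i v"
    by (metis scaleC_complex_def)
  define H where "H v = (\<chi> i. D i v)" for v
  have H: "(h has_derivative H) (at z)"
    by (rule has_derivative_vec_componentwise) (simp add: H_def D)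
  have H_smult: "H (c *s v) = c *s H v" for c v by (simp add: H_def D vec_eq_iff)
  obtain E where E: "(f has_derivative E) (at (h z))" "\<And>c v. E (c *s v) = c *\<^sub>C E v"
    using f maps z unfolding holomorphic_map_on_def by blast
  have "((\<lambda>z. f (h z)) has_derivative (\<lambda>v. E (H v))) (at z)"
    by (rule has_derivative_compose[OF H E(1)])
  moreover have "E (H (c *s v)) = c *\<^sub>C E (H v)" for c v by (simp add: H_smult E)
  ultimately show "\<exists>D. ((\<lambda>z. f (h z)) has_derivative D) (at z) \<and> (\<forall>c v. D (c *s v) = c *\<^sub>C D v)"
    by blast
qed

lemma holomorphic_map_on_scaleC:
  assumes a: "holomorphic_map_on a S" and f: "holomorphic_map_on f S"
  shows "holomorphic_map_on (\<lambda>z. a z *\<^sub>C f z) S"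
  unfolding holomorphic_map_on_def
proof
  fix z assume z: "z \<in> S"
  obtain A where A: "(a has_derivative A) (at z)" "\<And>c v. A (c *s v) = c * A v"
    using a z by (auto simp: holomorphic_map_on_def scaleC_complex_def)
  obtain D where D: "(f has_derivative D) (at z)" "\<And>c v. D (c *s v) = c *\<^sub>C D v"
    using f z by (auto simp: holomorphic_map_on_def)
  have "((\<lambda>z. a z *\<^sub>C f z) has_derivative (\<lambda>v. a z *\<^sub>C D v + A v *\<^sub>C f z)) (at z)"
    by (rule bounded_bilinear.FDERIV[OF bounded_bilinear_scaleC A(1) D(1)])
  moreover have "a z *\<^sub>C D (c *s v) + A (c *s v) *\<^sub>C f z = c *\<^sub>C (a z *\<^sub>C D v + A v *\<^sub>C f z)" for c v
    by (simp add: A D scaleC_add_right scaleC_scaleC mult.commute)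
  ultimately show "\<exists>D. ((\<lambda>z. a z *\<^sub>C f z) has_derivative D) (at z) \<and>
      (\<forall>c v. D (c *s v) = c *\<^sub>C D v)"
    by blast
qed

lemma holomorphic_map_on_const: "holomorphic_map_on (\<lambda>z. k :: complex) S"
  unfolding holomorphic_map_on_def
  by (intro ballI exI[of _ "\<lambda>v. 0"]) (simp add: scaleC_complex_def)

lemma holomorphic_map_on_nth: "holomorphic_map_on (\<lambda>z. z $ j) S"
  unfolding holomorphic_map_on_def
  by (intro ballI exI[of _ "\<lambda>v. v $ j"])
    (auto simp: scaleC_complex_def intro!: bounded_linear_imp_has_derivative)

lemma holomorphic_map_on_nth_divide:
  assumes "\<And>z. z \<in> S \<Longrightarrow> z $ k \<noteq> 0"
  shows "holomorphic_map_on (\<lambda>z. z $ j / z $ k) S"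
  unfolding holomorphic_map_on_def
proof
  fix z assume "z \<in> S"
  then have nz: "z $ k \<noteq> 0" by (rule assms)
  have nth: "((\<lambda>z. z $ i) has_derivative (\<lambda>v. v $ i)) (at z)" for i
    by (intro bounded_linear_imp_has_derivative bounded_linear_vec_nth)
  show "\<exists>D. ((\<lambda>z. z $ j / z $ k) has_derivative D) (at z) \<and> (\<forall>c v. D (c *s v) = c *\<^sub>C D v)"
    by (intro exI conjI, rule has_derivative_divide'[OF nth nth nz])
      (simp add: scaleC_complex_def algebra_simps diff_divide_distrib)
qed

section \<open>Restriction to the slice and homogeneous extension\<close>

lemma holomorphic_map_on_restrict_slice:
  assumes "holomorphic_map_on f Omega"
  shows "holomorphic_map_on (\<lambda>z'. f (append_coord z' 1)) Omega_plus"
proof (rule holomorphic_map_on_compose[OF assms])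
  fix i
  show "holomorphic_map_on (\<lambda>z'. append_coord z' 1 $ i) Omega_plus"
    by (cases i) (simp_all add: holomorphic_map_on_const holomorphic_map_on_nth)
qed (auto simp: Omega_plus_iff_append_coord)

lemma holomorphic_map_on_homogenize:
  assumes "holomorphic_map_on g Omega_plus"
  shows "holomorphic_map_on (\<lambda>z. z $ None *\<^sub>C g (dehomogenize z)) Omega"
proof (intro holomorphic_map_on_scaleC holomorphic_map_on_nth holomorphic_map_on_compose[OF assms])
  show "holomorphic_map_on (\<lambda>z. dehomogenize z $ j) Omega" for j
    by (simp add: dehomogenize_def holomorphic_map_on_nth_divide Omega_nth_nonzero)
qed (auto intro: dehomogenize_mem_Omega_plus)

text \<open>
  Euler's relation for the degree-one function \<open>f\<close>: scaling the point by \<open>1 / z\<^sub>N\<close> and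
  multiplying the value by \<open>z\<^sub>N\<close> cancel, so the restriction to the slice determines \<open>f\<close>.
\<close>

lemma class_P_homogenize_slice:
  assumes "f \<in> class_P" "z \<in> Omega"
  shows "z $ None *\<^sub>C f (append_coord (dehomogenize z) 1) = f z"
proof -
  have nz: "z $ None \<noteq> 0" using assms(2) by (rule Omega_nth_nonzero)
  then have "f (append_coord (dehomogenize z) 1) = inverse (z $ None) *\<^sub>C f z"
    using assms by (simp add: class_P_def append_coord_dehomogenize)
  then show ?thesis using nz by (simp add: scaleC_scaleC scaleC_one)
qed

lemma slice_of_class_P:
  assumes f: "f \<in> class_P"
  defines "g \<equiv> \<lambda>z'. f (append_coord z' 1)"
  shows "g ` Omega_plus \<subseteq> clinear_ops"
    and "holomorphic_map_on g Omega_plus"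
    and "z' \<in> Omega_plus \<Longrightarrow> g (cnj_vec z') = adj (g z')"
    and "z \<in> cpower rhp \<Longrightarrow> psd (Re_op (z $ None *\<^sub>C g (dehomogenize z)))"
proof -
  show "g ` Omega_plus \<subseteq> clinear_ops"
    using f by (auto simp: g_def class_P_def Omega_plus_iff_append_coord)
  show "holomorphic_map_on g Omega_plus"
    unfolding g_def using f by (intro holomorphic_map_on_restrict_slice) (simp add: class_P_def)
  show "g (cnj_vec z') = adj (g z')" if "z' \<in> Omega_plus"
    using f that append_coord_cnj_vec[of z' 1]
    by (simp add: g_def class_P_def Omega_plus_iff_append_coord)
  show "psd (Re_op (z $ None *\<^sub>C g (dehomogenize z)))" if z: "z \<in> cpower rhp"
  proof -
    have "z \<in> Omega" using z cpower_rhp_subset_Omega by blast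
    then have "z $ None *\<^sub>C g (dehomogenize z) = f z"
      unfolding g_def by (rule class_P_homogenize_slice[OF f])
    then show ?thesis using f z by (simp add: psd_Re_op_iff class_P_def)
  qed
qed

text \<open>
  The ratios \<open>z\<^sub>j / z\<^sub>N\<close> are invariant under scaling, so all of the homogeneity comes from the
  factor \<open>z\<^sub>N\<close>.  Conjugating \<open>z\<close> conjugates this factor and the ratios; the adjoint of the
  product conjugates the factor too and, by the symmetry of \<open>g\<close>, amounts to conjugating the
  argument of \<open>g\<close>.
\<close>

lemma homogenize_mem_class_P:
  assumes lin: "g ` Omega_plus \<subseteq> clinear_ops"
    and hol: "holomorphic_map_on g Omega_plus"
    and sym: "\<And>z'. z' \<in> Omega_plus \<Longrightarrow> g (cnj_vec z') = adj (g z')"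
    and pos: "\<And>z. z \<in> cpower rhp \<Longrightarrow> psd (Re_op (z $ None *\<^sub>C g (dehomogenize z)))"
  shows "(\<lambda>z. z $ None *\<^sub>C g (dehomogenize z)) \<in> class_P"
proof -
  have g_lin: "g (dehomogenize z) \<in> clinear_ops" if "z \<in> Omega" for z
    using lin dehomogenize_mem_Omega_plus[OF that] by blast
  have "cnj_vec z $ None *\<^sub>C g (dehomogenize (cnj_vec z)) = adj (z $ None *\<^sub>C g (dehomogenize z))"
    if z: "z \<in> Omega" for z
  proof -
    have "g (dehomogenize (cnj_vec z)) = adj (g (dehomogenize z))"
      by (simp add: dehomogenize_cnj_vec sym dehomogenize_mem_Omega_plus z)
    then show ?thesis by (simp add: adj_scaleC g_lin z cnj_vec_def)
  qed
  moreover have "(\<mu> *s z) $ None *\<^sub>C g (dehomogenize (\<mu> *s z)) =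
      \<mu> *\<^sub>C z $ None *\<^sub>C g (dehomogenize z)" if "\<mu> \<noteq> 0" for \<mu> z
    using that by (simp add: dehomogenize_smult scaleC_scaleC)
  ultimately show ?thesis
    using holomorphic_map_on_homogenize[OF hol] pos
    by (auto simp: class_P_def g_lin clinear_ops_scaleC psd_Re_op_iff)
qed

theorem theorem5p1:
  shows
    "(\<forall>f :: complex ^ ('n::finite) option \<Rightarrow> ('u::chilbert_space \<Rightarrow>\<^sub>L 'u).
        f \<in> class_P \<longrightarrow>
        (let g = (\<lambda>z' :: complex ^ 'n. f (append_coord z' 1)) in
          g ` Omega_plus \<subseteq> clinear_ops \<and>
          holomorphic_map_on g Omega_plus \<and>
          (\<forall>z'\<in>Omega_plus. g (cnj_vec z') = adj (g z')) \<and>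
          (\<forall>z\<in>cpower rhp. psd (Re_op (z $ None *\<^sub>C g (dehomogenize z))))))
     \<and>
     (\<forall>g :: complex ^ 'n \<Rightarrow> ('u \<Rightarrow>\<^sub>L 'u).
        g ` Omega_plus \<subseteq> clinear_ops \<and>
        holomorphic_map_on g Omega_plus \<and>
        (\<forall>z'\<in>Omega_plus. g (cnj_vec z') = adj (g z')) \<and>
        (\<forall>z\<in>cpower rhp. psd (Re_op (z $ None *\<^sub>C g (dehomogenize z)))) \<longrightarrow>
        (\<forall>z\<in>Omega :: (complex ^ 'n option) set.
            z $ None \<noteq> 0 \<and> dehomogenize z \<in> Omega_plus) \<and>
        (\<lambda>z. z $ None *\<^sub>C g (dehomogenize z)) \<in> class_P)"
proof (intro conjI allI impI)
  fix f :: "complex ^ 'n option \<Rightarrow> ('u \<Rightarrow>\<^sub>L 'u)"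
  assume "f \<in> class_P"
  from slice_of_class_P[OF this]
  show "let g = (\<lambda>z' :: complex ^ 'n. f (append_coord z' 1)) in
      g ` Omega_plus \<subseteq> clinear_ops \<and>
      holomorphic_map_on g Omega_plus \<and>
      (\<forall>z'\<in>Omega_plus. g (cnj_vec z') = adj (g z')) \<and>
      (\<forall>z\<in>cpower rhp. psd (Re_op (z $ None *\<^sub>C g (dehomogenize z))))"
    unfolding Let_def by blast
next
  fix g :: "complex ^ 'n \<Rightarrow> ('u \<Rightarrow>\<^sub>L 'u)"
  assume g: "g ` Omega_plus \<subseteq> clinear_ops \<and>
      holomorphic_map_on g Omega_plus \<and>
      (\<forall>z'\<in>Omega_plus. g (cnj_vec z') = adj (g z')) \<and>
      (\<forall>z\<in>cpower rhp. psd (Re_op (z $ None *\<^sub>C g (dehomogenize z))))"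
  show "\<forall>z\<in>Omega :: (complex ^ 'n option) set.
      z $ None \<noteq> 0 \<and> dehomogenize z \<in> Omega_plus"
    by (simp add: Omega_nth_nonzero dehomogenize_mem_Omega_plus)
  from g show "(\<lambda>z. z $ None *\<^sub>C g (dehomogenize z)) \<in> class_P"
    by (intro homogenize_mem_class_P) blast+
qed

end
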